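(* The equation $$u_{tt}=(uu_x)_x+uu_x$$ for $u=u(t,x)$ is conditionally invariant under each of the following operators: \begin{align*} (1)&\quad Q=\partial_x+a(t)\,\partial_u;\\ (2)&\quad Q=\partial_x+\tfrac14\left[\tanh\left(\tfrac12x\right)-1\right]u\,\partial_u;\\ (3)&\quad Q=\partial_x+\tfrac14\left[\coth\left(\tfrac12x\right)-1\right]u\,\partial_u;\\ (4)&\quad Q=\partial_x+\left[-\tfrac u2+\alpha t+\beta\right]\partial_u;\\ (5)&\quad Q=\partial_t+\partial_x. \end{align*} Here $\alpha,\beta$ are arbitrary constants and the function $a(t)$ is given implicitly by $$\pm\int^{a(t)}\frac{3}{\sqrt{6u^3+3c_1}}\,du-t-c_2=0,$$ where $c_1,c_2$ are constants.
   Context: Let $\mathcal L$: $L[u]=L(t,x,u_{(r)})=0$ be a differential equation of order $r$ for $u=u(t,x)$, where $u_{(r)}$ denotes $u$ together with all its derivatives of order at most $r$; $\mathcal L$ is identified with the manifold $L=0$ in the jet space $J^r$. For a vector field $Q=\tau(t,x,u)\partial_t+\xi(t,x,u)\partial_x+\eta(t,x,u)\partial_u$ with $(\tau,\xi)\neq(0,0)$ put $Q[u]:=\tau u_t+\xi u_x-\eta$ and let $\mathcal Q_{(r)}\subset J^r$ be the manifold defined by $D_t^\alpha D_x^\beta Q[u]=0$ for all $\alpha,\beta\ge0$ with $\alpha+\beta<r$, where $D_t,D_x$ are total derivatives. The equation $\mathcal L$ is called conditionally invariant with respect to $Q$ if $Q_{(r)}L\big|_{\mathcal L\cap\mathcal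 Q_{(r)}}=0$, where $Q_{(r)}$ is the standard $r$-th prolongation of $Q$ to $J^r$. All considerations are local, on domains where the coefficients are defined (e.g. $x\neq0$ in (3)). *)

theory Defs
  imports "HOL-Analysis.Analysis"
begin

section \<open>Jets of a scalar function of two variables\<close>

text \<open>Coordinates on jet space: \<^term>\<open>U a b\<close> stands for the derivative of \<open>u\<close> taken \<open>a\<close> times
  in \<open>t\<close> and \<open>b\<close> times in \<open>x\<close>, so \<^term>\<open>U 0 0\<close> is \<open>u\<close> itself. A jet carries derivatives of all
  orders; a function on \<open>J\<^sup>r\<close> is a function of jets satisfying \<open>of_order r\<close> below, and a subset of
  \<open>J\<^sup>r\<close> is represented by its preimage under the projection forgetting the derivatives of order
  greater than \<open>r\<close>.\<close>

datatype coord = T | X | U nat nat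

type_synonym jet = "coord \<Rightarrow> real"

definition jets_over :: "(real \<times> real \<times> real) set \<Rightarrow> jet set" where
  "jets_over \<Omega> = {z. (z T, z X, z (U 0 0)) \<in> \<Omega>}"

definition of_order :: "nat \<Rightarrow> jet set \<Rightarrow> (jet \<Rightarrow> real) \<Rightarrow> bool" where
  "of_order r W F \<longleftrightarrow>
     (\<forall>z\<in>W. \<forall>w\<in>W. z T = w T \<longrightarrow> z X = w X \<longrightarrow> (\<forall>a b. a + b \<le> r \<longrightarrow> z (U a b) = w (U a b)) \<longrightarrow> F z = F w)"

definition pd :: "coord \<Rightarrow> (jet \<Rightarrow> real) \<Rightarrow> jet \<Rightarrow> real" where
  "pd c F z = deriv (\<lambda>s. F (z(c := s))) (z c)"

text \<open>Infinitely often differentiable: \<open>F\<close> is continuous on \<open>W\<close> and has all partial derivatives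
  there, and these are again smooth.\<close>

coinductive smooth :: "jet set \<Rightarrow> (jet \<Rightarrow> real) \<Rightarrow> bool" for W where
  "continuous_on W F \<Longrightarrow>
   (\<And>c z. z \<in> W \<Longrightarrow> (\<lambda>s. F (z(c := s))) field_differentiable at (z c)) \<Longrightarrow>
   (\<And>c. smooth W (pd c F)) \<Longrightarrow> smooth W F"

text \<open>Total derivatives. For \<open>F\<close> of finite order only finitely many summands are nonzero; the sum
  is restricted to these because sums over infinite sets are \<open>0\<close> by convention.\<close>

definition Dt :: "(jet \<Rightarrow> real) \<Rightarrow> jet \<Rightarrow> real" where
  "Dt F z = pd T F z + (\<Sum>(a, b) | pd (U a b) F z \<noteq> 0. z (U (Suc a) b) * pd (U a b) F z)"

definition Dx :: "(jet \<Rightarrow> real) \<Rightarrow> jet \<Rightarrow> real" where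
  "Dx F z = pd X F z + (\<Sum>(a, b) | pd (U a b) F z \<noteq> 0. z (U a (Suc b)) * pd (U a b) F z)"


section \<open>Vector fields and conditional invariance\<close>

text \<open>\<^term>\<open>VF \<tau> \<xi> \<eta>\<close> is the vector field with coefficients \<open>\<tau>(t,x,u)\<close>, \<open>\<xi>(t,x,u)\<close>, \<open>\<eta>(t,x,u)\<close>
  along \<open>t\<close>, \<open>x\<close>, \<open>u\<close>.\<close>

datatype vfield =
  VF (tau: "real \<Rightarrow> real \<Rightarrow> real \<Rightarrow> real") (xi: "real \<Rightarrow> real \<Rightarrow> real \<Rightarrow> real")
     (eta: "real \<Rightarrow> real \<Rightarrow> real \<Rightarrow> real")

definition lift :: "(real \<Rightarrow> real \<Rightarrow> real \<Rightarrow> real) \<Rightarrow> jet \<Rightarrow> real" where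
  "lift f z = f (z T) (z X) (z (U 0 0))"

definition charac :: "vfield \<Rightarrow> jet \<Rightarrow> real" where
  "charac Q z = lift (tau Q) z * z (U 1 0) + lift (xi Q) z * z (U 0 1) - lift (eta Q) z"

text \<open>The manifold \<open>D\<^sub>t\<^sup>\<alpha> D\<^sub>x\<^sup>\<beta> Q[u] = 0\<close>, \<open>\<alpha> + \<beta> < r\<close>.\<close>

definition invariant_surface :: "nat \<Rightarrow> vfield \<Rightarrow> jet set" where
  "invariant_surface r Q = {z. \<forall>\<alpha> \<beta>. \<alpha> + \<beta> < r \<longrightarrow> (Dt ^^ \<alpha>) ((Dx ^^ \<beta>) (charac Q)) z = 0}"

text \<open>Standard prolongation, by the general prolongation formula
  \<open>\<eta>\<^sup>a\<^sup>b = D\<^sub>t\<^sup>a D\<^sub>x\<^sup>b (\<eta> - \<tau> u\<^sub>t - \<xi> u\<^sub>x) + \<tau> D\<^sub>t u\<^sub>a\<^sub>b + \<xi> D\<^sub>x u\<^sub>a\<^sub>b\<close>, in which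
  \<open>\<eta> - \<tau> u\<^sub>t - \<xi> u\<^sub>x = - Q[u]\<close> and the derivatives of order \<open>a + b + 1\<close> cancel.\<close>

definition prolong_coeff :: "vfield \<Rightarrow> nat \<Rightarrow> nat \<Rightarrow> jet \<Rightarrow> real" where
  "prolong_coeff Q a b z =
     (Dt ^^ a) ((Dx ^^ b) (\<lambda>w. - charac Q w)) z
       + lift (tau Q) z * z (U (Suc a) b) + lift (xi Q) z * z (U a (Suc b))"

definition prolong :: "nat \<Rightarrow> vfield \<Rightarrow> (jet \<Rightarrow> real) \<Rightarrow> jet \<Rightarrow> real" where
  "prolong r Q F z =
     lift (tau Q) z * pd T F z + lift (xi Q) z * pd X F z
       + (\<Sum>(a, b) | a + b \<le> r. prolong_coeff Q a b z * pd (U a b) F z)"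

definition vector_field_on :: "(real \<times> real \<times> real) set \<Rightarrow> vfield \<Rightarrow> bool" where
  "vector_field_on \<Omega> Q \<longleftrightarrow>
     smooth (jets_over \<Omega>) (lift (tau Q)) \<and> smooth (jets_over \<Omega>) (lift (xi Q)) \<and>
     smooth (jets_over \<Omega>) (lift (eta Q)) \<and>
     (\<forall>(t, x, u)\<in>\<Omega>. (tau Q t x u, xi Q t x u) \<noteq> (0, 0))"

text \<open>Conditional invariance of the equation \<open>L = 0\<close> of order \<open>r\<close> with respect to \<open>Q\<close>, over an
  open set \<open>\<Omega>\<close> of points \<open>(t, x, u)\<close>.\<close>

definition cond_invariant :: "(real \<times> real \<times> real) set \<Rightarrow> nat \<Rightarrow> (jet \<Rightarrow> real) \<Rightarrow> vfield \<Rightarrow> bool" where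
  "cond_invariant \<Omega> r L Q \<longleftrightarrow>
     open \<Omega> \<and> of_order r (jets_over \<Omega>) L \<and> smooth (jets_over \<Omega>) L \<and> vector_field_on \<Omega> Q \<and>
     (\<forall>z \<in> jets_over \<Omega> \<inter> {z. L z = 0} \<inter> invariant_surface r Q. prolong r Q L z = 0)"


section \<open>The nonlinear wave equation\<close>

text \<open>\<open>u\<^sub>t\<^sub>t - ((u u\<^sub>x)\<^sub>x + u u\<^sub>x)\<close>, with the outer \<open>x\<close>-derivative as a total derivative.\<close>

definition wave :: "jet \<Rightarrow> real" where
  "wave z = z (U 2 0) - (Dx (\<lambda>w. w (U 0 0) * w (U 0 1)) z + z (U 0 0) * z (U 0 1))"

definition coth :: "real \<Rightarrow> real" where
  "coth x = cosh x / sinh x"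

text \<open>\<open>a\<close> is given on \<open>I\<close> by \<open>\<plusminus>\<integral>\<^sup>a\<^sup>(\<^sup>t\<^sup>) 3 / sqrt (6u\<^sup>3 + 3c\<^sub>1) du - t - c\<^sub>2 = 0\<close>. The indefinite integral
  is an arbitrary antiderivative \<open>G\<close> of the integrand on the interval where the radicand is
  positive, and \<open>\<sigma>\<close> is the sign. No regularity of \<open>a\<close> is assumed.\<close>

definition implicitly_given :: "real set \<Rightarrow> (real \<Rightarrow> real) \<Rightarrow> real \<Rightarrow> real \<Rightarrow> bool" where
  "implicitly_given I a c1 c2 \<longleftrightarrow>
     (\<exists>\<sigma>\<in>{1, -1}. \<exists>G.
        (\<forall>u. 6 * u ^ 3 + 3 * c1 > 0 \<longrightarrow>
           (G has_real_derivative 3 / sqrt (6 * u ^ 3 + 3 * c1)) (at u)) \<and>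
        (\<forall>t\<in>I. 6 * a t ^ 3 + 3 * c1 > 0 \<and> \<sigma> * G (a t) - t - c2 = 0))"

end

theory Submission
  imports Defs
begin

text \<open>All five operators have the form \<open>\<tau> \<partial>\<^sub>t + \<partial>\<^sub>x + (f(x) u + g(t)) \<partial>\<^sub>u\<close> with a constant \<open>\<tau>\<close>.
  For \<open>\<tau> = 0\<close> the invariant surface gives \<open>u\<^sub>x = f u + g\<close> and \<open>u\<^sub>x\<^sub>x = f' u + f u\<^sub>x\<close>, and the equation
  gives \<open>u\<^sub>t\<^sub>t\<close>; after substitution the invariance condition is a quadratic polynomial in \<open>u\<close>, whose
  coefficients vanish iff \<open>f'' + 5 f f' + 2 f\<^sup>3 + f\<^sup>2 + f' = 0\<close>, \<open>g (4 f\<^sup>2 + 2 f + 5 f') = 0\<close> and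
  \<open>g'' = (2 f + 1) g\<^sup>2\<close>. For \<open>f = 0\<close> this is \<open>a'' = a\<^sup>2\<close>, whose first integral is
  \<open>9 a'\<^sup>2 = 6 a\<^sup>3 + 3 c\<^sub>1\<close>. Operator (5) is a symmetry: its prolongation annihilates the
  equation identically.\<close>

section \<open>Smooth functions on jet space\<close>

lemma open_jets_over:
  assumes "open \<Omega>"
  shows "open (jets_over \<Omega>)"
proof -
  have "continuous_on UNIV (\<lambda>z::jet. (z T, z X, z (U 0 0)))"
    by (intro continuous_intros continuous_on_product_coordinates)
  then have "open ((\<lambda>z::jet. (z T, z X, z (U 0 0))) -` \<Omega>)"
    using assms open_vimage by blast
  then show ?thesis
    by (simp add: jets_over_def vimage_def)
qed

text \<open>Moving one coordinate is continuous for the product topology on jets, so a small move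
  stays in \<open>W\<close>. This makes partial derivatives on open sets local.\<close>

lemma eventually_upd_in_open:
  fixes z :: jet
  assumes "open W" "z \<in> W"
  shows "eventually (\<lambda>s. z(c := s) \<in> W) (nhds (z c))"
proof -
  have "continuous_on UNIV (\<lambda>s. (z(c := s)) d)" for d
    by (cases "d = c") auto
  then have "continuous_on UNIV (\<lambda>s. z(c := s))"
    by (rule continuous_on_coordinatewise_then_product)
  then have "open ((\<lambda>s. z(c := s)) -` W)"
    using assms(1) open_vimage by blast
  moreover have "z c \<in> (\<lambda>s. z(c := s)) -` W"
    using assms(2) by simp
  ultimately show ?thesis
    unfolding eventually_nhds by blast
qed

lemma DERIV_upd_cong:
  fixes z :: jet
  assumes "open W" "z \<in> W" "\<And>w. w \<in> W \<Longrightarrow> F w = G w"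
  shows "((\<lambda>s. F (z(c := s))) has_real_derivative D) (at (z c))
    \<longleftrightarrow> ((\<lambda>s. G (z(c := s))) has_real_derivative D) (at (z c))"
proof (rule DERIV_cong_ev)
  show "eventually (\<lambda>s. F (z(c := s)) = G (z(c := s))) (nhds (z c))"
    using eventually_upd_in_open[OF assms(1,2), of c] by eventually_elim (rule assms(3))
qed auto

lemma pd_cong:
  assumes "open W" "z \<in> W" "\<And>w. w \<in> W \<Longrightarrow> F w = G w"
  shows "pd c F z = pd c G z"
proof -
  have "((\<lambda>s. F (z(c := s))) has_real_derivative D) (at (z c))
    \<longleftrightarrow> ((\<lambda>s. G (z(c := s))) has_real_derivative D) (at (z c))" for D
    using assms by (rule DERIV_upd_cong)
  then show ?thesis
    by (simp add: pd_def deriv_def)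
qed

lemma pd_eqI:
  "((\<lambda>s. F (z(c := s))) has_real_derivative D) (at (z c)) \<Longrightarrow> pd c F z = D"
  unfolding pd_def by (rule DERIV_imp_deriv)

text \<open>The Kronecker delta lets a single formula serve all coordinates \<open>c\<close>,
  without case distinctions.\<close>

lemma DERIV_coord [derivative_intros]:
  "((\<lambda>s. (z(c := s)) d) has_real_derivative of_bool (d = c)) (at r)"
  by (cases "d = c") auto

lemma DERIV_comp_coord:
  assumes "(h has_real_derivative D) (at (z d))"
  shows "((\<lambda>s. h ((z(c := s)) d)) has_real_derivative D * of_bool (d = c)) (at (z c))"
  by (rule DERIV_chain2[OF _ DERIV_coord]) (use assms in simp)

text \<open>If the partial derivatives of the generators \<open>B\<close> lie in the algebra they generate, then so do
  those of every element; this makes the algebra an invariant for coinduction on \<^const>\<open>smooth\<close>.\<close>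

inductive alg :: "(jet \<Rightarrow> real) set \<Rightarrow> (jet \<Rightarrow> real) \<Rightarrow> bool" for B where
  alg_base: "F \<in> B \<Longrightarrow> alg B F"
| alg_coord: "alg B (\<lambda>z. z c)"
| alg_const: "alg B (\<lambda>z. k)"
| alg_add: "alg B F \<Longrightarrow> alg B G \<Longrightarrow> alg B (\<lambda>z. F z + G z)"
| alg_mult: "alg B F \<Longrightarrow> alg B G \<Longrightarrow> alg B (\<lambda>z. F z * G z)"

lemma alg_diff:
  assumes "alg B F" "alg B G"
  shows "alg B (\<lambda>z. F z - G z)"
  using alg_add[OF assms(1) alg_mult[OF alg_const[of B "-1"] assms(2)]] by simp

section \<open>Closure of the generated algebra under partial derivatives\<close>

context
  fixes W B
  assumes W: "open W"
    and cont: "\<And>F. F \<in> B \<Longrightarrow> continuous_on W F"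
    and closed: "\<And>F c. F \<in> B \<Longrightarrow> \<exists>G. alg B G \<and>
          (\<forall>z\<in>W. ((\<lambda>s. F (z(c := s))) has_real_derivative G z) (at (z c)))"
begin

lemma alg_continuous: "alg B F \<Longrightarrow> continuous_on W F"
  by (induction rule: alg.induct)
     (auto intro: cont continuous_intros continuous_on_subset[OF continuous_on_product_coordinates])

lemma alg_partial:
  "alg B F \<Longrightarrow> \<exists>G. alg B G \<and>
     (\<forall>z\<in>W. ((\<lambda>s. F (z(c := s))) has_real_derivative G z) (at (z c)))"
proof (induction rule: alg.induct)
  case (alg_base F)
  then show ?case by (rule closed)
next
  case (alg_coord d)
  show ?case
    by (intro exI[of _ "\<lambda>z. of_bool (d = c)"] conjI ballI alg_const DERIV_coord)
next
  case (alg_const k)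
  show ?case
    by (intro exI[of _ "\<lambda>z. 0"] conjI ballI alg.alg_const DERIV_const)
next
  case (alg_add F G)
  then obtain F' G' where
    "alg B F'" "\<forall>z\<in>W. ((\<lambda>s. F (z(c := s))) has_real_derivative F' z) (at (z c))"
    "alg B G'" "\<forall>z\<in>W. ((\<lambda>s. G (z(c := s))) has_real_derivative G' z) (at (z c))"
    by blast
  then show ?case
    by (intro exI[of _ "\<lambda>z. F' z + G' z"] conjI ballI alg.alg_add DERIV_add)
       (auto simp del: fun_upd_apply)
next
  case (alg_mult F G)
  then obtain F' G' where F': "alg B F'"
      "\<forall>z\<in>W. ((\<lambda>s. F (z(c := s))) has_real_derivative F' z) (at (z c))"
    and G': "alg B G'"
      "\<forall>z\<in>W. ((\<lambda>s. G (z(c := s))) has_real_derivative G' z) (at (z c))"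
    by blast
  have "((\<lambda>s. F (z(c := s)) * G (z(c := s))) has_real_derivative F' z * G z + G' z * F z) (at (z c))"
    if "z \<in> W" for z
    \<comment> \<open>The product rule evaluates the undifferentiated factors at
      \<open>z(c := z c)\<close>, which is \<open>z\<close>.\<close>
    using DERIV_mult[OF bspec[OF F'(2) that] bspec[OF G'(2) that]] by (simp only: fun_upd_triv)
  moreover have "alg B (\<lambda>z. F' z * G z + G' z * F z)"
    using alg_mult.hyps F'(1) G'(1) by (intro alg.alg_add alg.alg_mult)
  ultimately show ?case
    by blast
qed

text \<open>The coinduction invariant is agreement on \<open>W\<close> with some element of the
  algebra, not membership in it: \<open>pd c F\<close> is known to match an algebra element on
  \<open>W\<close> only.\<close>

lemma smooth_alg:
  assumes "alg B F"
  shows "smooth W F"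
proof -
  have "\<exists>F. alg B F \<and> (\<forall>z\<in>W. F z = G z) \<Longrightarrow> smooth W G" for G
  proof (coinduction arbitrary: G rule: smooth.coinduct)
    case smooth
    then obtain F where F: "alg B F" "\<And>z. z \<in> W \<Longrightarrow> G z = F z"
      by auto
    have "continuous_on W G"
      using alg_continuous[OF F(1)] F(2) by (simp cong: continuous_on_cong)
    moreover have "(\<lambda>s. G (z(c := s))) field_differentiable at (z c)" if z: "z \<in> W" for c z
    proof -
      obtain H where "\<forall>z\<in>W. ((\<lambda>s. F (z(c := s))) has_real_derivative H z) (at (z c))"
        using alg_partial[OF F(1), of c] by (elim exE conjE)
      then have "((\<lambda>s. F (z(c := s))) has_real_derivative H z) (at (z c))"
        using z by (rule bspec)
      then have "((\<lambda>s. G (z(c := s))) has_real_derivative H z) (at (z c))"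
        unfolding DERIV_upd_cong[of W z G F c "H z", OF W z F(2), simplified] .
      then show ?thesis
        unfolding field_differentiable_def by (rule exI)
    qed
    moreover have "\<exists>H. alg B H \<and> (\<forall>z\<in>W. H z = pd c G z)" for c
    proof -
      obtain H where H: "alg B H"
        "\<forall>z\<in>W. ((\<lambda>s. F (z(c := s))) has_real_derivative H z) (at (z c))"
        using alg_partial[OF F(1), of c] by (elim exE conjE)
      have "H z = pd c G z" if z: "z \<in> W" for z
      proof -
        have "pd c G z = pd c F z"
          using W z F(2) by (rule pd_cong)
        also have "\<dots> = H z"
          by (rule pd_eqI) (rule H(2)[rule_format, OF z])
        finally show ?thesis ..
      qed
      with H(1) show ?thesis by blast
    qed
    ultimately show ?case
      by (simp del: fun_upd_apply)
  qed
  with assms show ?thesis by blast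
qed

end

text \<open>Without generators the algebra consists of the polynomials in the jet
  coordinates.\<close>

lemma smooth_poly:
  assumes "open W" "alg {} F"
  shows "smooth W F"
  by (rule smooth_alg[OF assms(1) _ _ assms(2)]) auto

section \<open>Total derivatives\<close>

text \<open>The index set in \<open>Dt\<close> and \<open>Dx\<close> depends on where derivatives
  vanish; adding zero summands turns it into an explicit finite set.\<close>

lemma total_sum_eq:
  fixes v :: "nat \<Rightarrow> nat \<Rightarrow> real"
  assumes "finite S" "\<And>a b. (a, b) \<notin> S \<Longrightarrow> d (U a b) = (0::real)"
  shows "(\<Sum>(a, b) | d (U a b) \<noteq> 0. v a b * d (U a b)) = (\<Sum>(a, b)\<in>S. v a b * d (U a b))"
  using assms by (intro sum.mono_neutral_left) auto

lemma Dx_eqI: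
  assumes d: "\<And>c. ((\<lambda>s. F (z(c := s))) has_real_derivative d c) (at (z c))"
    and S: "finite S" "\<And>a b. (a, b) \<notin> S \<Longrightarrow> d (U a b) = 0"
  shows "Dx F z = d X + (\<Sum>(a, b)\<in>S. z (U a (Suc b)) * d (U a b))"
proof -
  have "pd c F z = d c" for c
    using d by (rule pd_eqI)
  then show ?thesis
    using total_sum_eq[of S d "\<lambda>a b. z (U a (Suc b))"] S by (simp add: Dx_def)
qed

lemma Dt_eqI:
  assumes d: "\<And>c. ((\<lambda>s. F (z(c := s))) has_real_derivative d c) (at (z c))"
    and S: "finite S" "\<And>a b. (a, b) \<notin> S \<Longrightarrow> d (U a b) = 0"
  shows "Dt F z = d T + (\<Sum>(a, b)\<in>S. z (U (Suc a) b) * d (U a b))"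
proof -
  have "pd c F z = d c" for c
    using d by (rule pd_eqI)
  then show ?thesis
    using total_sum_eq[of S d "\<lambda>a b. z (U (Suc a) b)"] S by (simp add: Dt_def)
qed

text \<open>Serves second total derivatives, where the first one is given by a formula on an open
  set only.\<close>

lemma Dx_cong:
  assumes "open W" "z \<in> W" "\<And>w. w \<in> W \<Longrightarrow> F w = G w"
  shows "Dx F z = Dx G z"
proof -
  have "pd c F z = pd c G z" for c
    using assms by (rule pd_cong)
  then show ?thesis
    by (simp add: Dx_def)
qed

lemma Dt_cong:
  assumes "open W" "z \<in> W" "\<And>w. w \<in> W \<Longrightarrow> F w = G w"
  shows "Dt F z = Dt G z"
proof -
  have "pd c F z = pd c G z" for c
    using assms by (rule pd_cong)
  then show ?thesis
    by (simp add: Dt_def)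
qed

section \<open>The wave equation\<close>

lemma wave_eq:
  "wave = (\<lambda>z. z (U 2 0) - (z (U 0 1) * z (U 0 1) + z (U 0 0) * z (U 0 2) + z (U 0 0) * z (U 0 1)))"
proof
  fix z
  have "Dx (\<lambda>w. w (U 0 0) * w (U 0 1)) z =
    of_bool (U 0 0 = X) * z (U 0 1) + of_bool (U 0 1 = X) * z (U 0 0) +
    (\<Sum>(a, b)\<in>{(0,0), (0,1)}. z (U a (Suc b)) *
      (of_bool (U 0 0 = U a b) * z (U 0 1) + of_bool (U 0 1 = U a b) * z (U 0 0)))"
    by (rule Dx_eqI) (auto intro!: derivative_eq_intros)
  also have "\<dots> = z (U 0 1) * z (U 0 1) + z (U 0 0) * z (U 0 2)"
    by (simp add: numeral_2_eq_2)
  finally show "wave z =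
      z (U 2 0) - (z (U 0 1) * z (U 0 1) + z (U 0 0) * z (U 0 2) + z (U 0 0) * z (U 0 1))"
    by (simp add: wave_def)
qed

lemma pd_wave:
  "pd c wave z = of_bool (U 2 0 = c) - of_bool (U 0 0 = c) * (z (U 0 2) + z (U 0 1))
     - of_bool (U 0 1 = c) * (2 * z (U 0 1) + z (U 0 0)) - of_bool (U 0 2 = c) * z (U 0 0)"
  unfolding wave_eq by (rule pd_eqI) (auto intro!: derivative_eq_intros simp: algebra_simps)

lemma of_order_wave: "of_order 2 W wave"
  by (auto simp: of_order_def wave_eq)

lemma smooth_wave: "open W \<Longrightarrow> smooth W wave"
  unfolding wave_eq by (intro smooth_poly alg_diff alg_add alg_mult alg_coord)

text \<open>The wave expression involves none of \<open>t\<close>, \<open>x\<close>,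
  \<open>u_t\<close>, \<open>u_tx\<close>, so four prolongation coefficients survive.\<close>

lemma prolong_wave:
  "prolong 2 Q wave z = prolong_coeff Q 2 0 z - prolong_coeff Q 0 0 z * (z (U 0 2) + z (U 0 1))
     - prolong_coeff Q 0 1 z * (2 * z (U 0 1) + z (U 0 0)) - prolong_coeff Q 0 2 z * z (U 0 0)"
proof -
  have "{(a, b). a + b \<le> (2::nat)} = {(0,0), (0,1), (0,2), (1,0), (1,1), (2,0)}"
    by (auto simp: numeral_2_eq_2 le_Suc_eq)
  then show ?thesis
    by (simp add: prolong_def pd_wave algebra_simps)
qed

section \<open>Operators with affine coefficients\<close>

text \<open>Derivatives are prescribed only at those \<open>x\<close> and \<open>t\<close> that
  occur in \<open>\<Omega>\<close>; this admits the pole of \<open>coth\<close> at 0 and a function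
  \<open>a\<close> controlled only on \<open>I\<close>.\<close>

locale affine_operator =
  fixes \<Omega> :: "(real \<times> real \<times> real) set" and f f1 f2 g g1 g2 :: "real \<Rightarrow> real" and \<tau> :: real
  assumes \<Omega>: "open \<Omega>"
    and f: "\<And>t x u. (t, x, u) \<in> \<Omega> \<Longrightarrow> (f has_real_derivative f1 x) (at x)"
    and f1: "\<And>t x u. (t, x, u) \<in> \<Omega> \<Longrightarrow> (f1 has_real_derivative f2 x) (at x)"
    and g: "\<And>t x u. (t, x, u) \<in> \<Omega> \<Longrightarrow> (g has_real_derivative g1 t) (at t)"
    and g1: "\<And>t x u. (t, x, u) \<in> \<Omega> \<Longrightarrow> (g1 has_real_derivative g2 t) (at t)"
begin

abbreviation (input) aff_field :: vfield where
  "aff_field \<equiv> VF (\<lambda>t x u. \<tau>) (\<lambda>t x u. 1) (\<lambda>t x u. f x * u + g t)"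

text \<open>The factor \<open>k\<close> treats \<open>Q[u]\<close>, which defines the invariant surface, and \<open>-Q[u]\<close>, which enters
  the prolongation formula, at once.\<close>

lemma Dx_charac:
  assumes z: "z \<in> jets_over \<Omega>"
  shows "Dx (\<lambda>w. k * charac aff_field w) z
    = k * (\<tau> * z (U 1 1) + z (U 0 2) - f1 (z X) * z (U 0 0) - f (z X) * z (U 0 1))"
proof -
  have h: "(f has_real_derivative f1 (z X)) (at (z X))" "(g has_real_derivative g1 (z T)) (at (z T))"
    using z f g by (auto simp: jets_over_def)
  \<comment> \<open>\<open>d c\<close> is the partial derivative of \<open>k * Q[u]\<close> at
    \<open>z\<close> along \<open>c\<close>, for every coordinate at once.\<close>
  define d where "d c = k * (\<tau> * of_bool (U 1 0 = c) + of_bool (U 0 1 = c)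
    - (f1 (z X) * of_bool (X = c) * z (U 0 0) + of_bool (U 0 0 = c) * f (z X))
    - g1 (z T) * of_bool (T = c))" for c
  have "Dx (\<lambda>w. k * charac aff_field w) z
    = d X + (\<Sum>(a, b)\<in>{(0,0), (0,1), (1,0)}. z (U a (Suc b)) * d (U a b))"
    unfolding charac_def lift_def vfield.sel
    by (rule Dx_eqI) (auto simp: d_def algebra_simps
      intro!: derivative_eq_intros DERIV_comp_coord[of f _ z X, OF h(1)] h DERIV_comp_coord[of g _ z T, OF h(2)])
  also have "\<dots> = k * (\<tau> * z (U 1 1) + z (U 0 2) - f1 (z X) * z (U 0 0) - f (z X) * z (U 0 1))"
    by (simp add: d_def algebra_simps numeral_2_eq_2)
  finally show ?thesis .
qed

lemma Dt_charac:
  assumes z: "z \<in> jets_over \<Omega>"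
  shows "Dt (\<lambda>w. k * charac aff_field w) z
    = k * (\<tau> * z (U 2 0) + z (U 1 1) - f (z X) * z (U 1 0) - g1 (z T))"
proof -
  have h: "(f has_real_derivative f1 (z X)) (at (z X))" "(g has_real_derivative g1 (z T)) (at (z T))"
    using z f g by (auto simp: jets_over_def)
  define d where "d c = k * (\<tau> * of_bool (U 1 0 = c) + of_bool (U 0 1 = c)
    - (f1 (z X) * of_bool (X = c) * z (U 0 0) + of_bool (U 0 0 = c) * f (z X))
    - g1 (z T) * of_bool (T = c))" for c
  have "Dt (\<lambda>w. k * charac aff_field w) z
    = d T + (\<Sum>(a, b)\<in>{(0,0), (0,1), (1,0)}. z (U (Suc a) b) * d (U a b))"
    unfolding charac_def lift_def vfield.sel
    by (rule Dt_eqI) (auto simp: d_def algebra_simps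
      intro!: derivative_eq_intros DERIV_comp_coord[of f _ z X, OF h(1)] h DERIV_comp_coord[of g _ z T, OF h(2)])
  also have "\<dots> = k * (\<tau> * z (U 2 0) + z (U 1 1) - f (z X) * z (U 1 0) - g1 (z T))"
    by (simp add: d_def algebra_simps numeral_2_eq_2)
  finally show ?thesis .
qed

lemma Dxx_charac:
  assumes z: "z \<in> jets_over \<Omega>"
  shows "Dx (Dx (\<lambda>w. k * charac aff_field w)) z
    = k * (\<tau> * z (U 1 2) + z (U 0 3) - f2 (z X) * z (U 0 0) - 2 * f1 (z X) * z (U 0 1)
        - f (z X) * z (U 0 2))"
proof -
  have h: "(f has_real_derivative f1 (z X)) (at (z X))" "(f1 has_real_derivative f2 (z X)) (at (z X))"
    using z f f1 by (auto simp: jets_over_def)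
  define d where "d c = k * (\<tau> * of_bool (U 1 1 = c) + of_bool (U 0 2 = c)
    - (f2 (z X) * of_bool (X = c) * z (U 0 0) + of_bool (U 0 0 = c) * f1 (z X))
    - (f1 (z X) * of_bool (X = c) * z (U 0 1) + of_bool (U 0 1 = c) * f (z X)))" for c
  have "Dx (Dx (\<lambda>w. k * charac aff_field w)) z
    = Dx (\<lambda>z. k * (\<tau> * z (U 1 1) + z (U 0 2) - f1 (z X) * z (U 0 0) - f (z X) * z (U 0 1))) z"
    by (rule Dx_cong[OF open_jets_over[OF \<Omega>] z Dx_charac])
  also have "\<dots> = d X + (\<Sum>(a, b)\<in>{(0,0), (0,1), (0,2), (1,1)}. z (U a (Suc b)) * d (U a b))"
    by (rule Dx_eqI) (auto simp: d_def algebra_simps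
      intro!: derivative_eq_intros DERIV_comp_coord[of f _ z X, OF h(1)] h DERIV_comp_coord[of f1 _ z X, OF h(2)])
  also have "\<dots> = k * (\<tau> * z (U 1 2) + z (U 0 3) - f2 (z X) * z (U 0 0) - 2 * f1 (z X) * z (U 0 1)
        - f (z X) * z (U 0 2))"
    by (simp add: d_def algebra_simps numeral_2_eq_2 numeral_3_eq_3)
  finally show ?thesis .
qed

lemma Dtt_charac:
  assumes z: "z \<in> jets_over \<Omega>"
  shows "Dt (Dt (\<lambda>w. k * charac aff_field w)) z
    = k * (\<tau> * z (U 3 0) + z (U 2 1) - f (z X) * z (U 2 0) - g2 (z T))"
proof -
  have h: "(f has_real_derivative f1 (z X)) (at (z X))" "(g1 has_real_derivative g2 (z T)) (at (z T))"
    using z f g1 by (auto simp: jets_over_def)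
  define d where "d c = k * (\<tau> * of_bool (U 2 0 = c) + of_bool (U 1 1 = c)
    - (f1 (z X) * of_bool (X = c) * z (U 1 0) + of_bool (U 1 0 = c) * f (z X))
    - g2 (z T) * of_bool (T = c))" for c
  have "Dt (Dt (\<lambda>w. k * charac aff_field w)) z
    = Dt (\<lambda>z. k * (\<tau> * z (U 2 0) + z (U 1 1) - f (z X) * z (U 1 0) - g1 (z T))) z"
    by (rule Dt_cong[OF open_jets_over[OF \<Omega>] z Dt_charac])
  also have "\<dots> = d T + (\<Sum>(a, b)\<in>{(2,0), (1,1), (1,0)}. z (U (Suc a) b) * d (U a b))"
    by (rule Dt_eqI) (auto simp: d_def algebra_simps
      intro!: derivative_eq_intros DERIV_comp_coord[of f _ z X, OF h(1)] h DERIV_comp_coord[of g1 _ z T, OF h(2)])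
  also have "\<dots> = k * (\<tau> * z (U 3 0) + z (U 2 1) - f (z X) * z (U 2 0) - g2 (z T))"
    by (simp add: d_def algebra_simps numeral_2_eq_2 numeral_3_eq_3)
  finally show ?thesis .
qed

text \<open>This is the case \<open>k = -1\<close>. As \<open>\<tau>\<close> and the coefficient 1
  of the \<open>x\<close>-direction are constant, the derivatives of \<open>\<tau> u_t + u_x\<close>
  cancel against the added terms, leaving total derivatives of \<open>f u + g\<close>.\<close>

lemma prolong_coeff_aff:
  assumes z: "z \<in> jets_over \<Omega>"
  shows "prolong_coeff aff_field 0 0 z = f (z X) * z (U 0 0) + g (z T)"
    and "prolong_coeff aff_field 0 1 z = f1 (z X) * z (U 0 0) + f (z X) * z (U 0 1)"
    and "prolong_coeff aff_field 0 2 z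
      = f2 (z X) * z (U 0 0) + 2 * f1 (z X) * z (U 0 1) + f (z X) * z (U 0 2)"
    and "prolong_coeff aff_field 2 0 z = f (z X) * z (U 2 0) + g2 (z T)"
  using Dx_charac[OF z, of "-1"] Dxx_charac[OF z, of "-1"] Dtt_charac[OF z, of "-1"]
  by (simp_all add: prolong_coeff_def charac_def lift_def numeral_2_eq_2 numeral_3_eq_3)

text \<open>These are Q[u] = 0 and its total \<open>x\<close>-derivative. For
  \<open>\<tau> = 0\<close> they express \<open>u_x\<close> and \<open>u_xx\<close> through
  \<open>u\<close>.\<close>

lemma aff_invariant_surface:
  assumes z: "z \<in> jets_over \<Omega>" and "z \<in> invariant_surface 2 aff_field"
  shows "\<tau> * z (U 1 0) + z (U 0 1) = f (z X) * z (U 0 0) + g (z T)"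
    and "\<tau> * z (U 1 1) + z (U 0 2) = f1 (z X) * z (U 0 0) + f (z X) * z (U 0 1)"
proof -
  have s: "\<alpha> + \<beta> < 2 \<Longrightarrow> (Dt ^^ \<alpha>) ((Dx ^^ \<beta>) (charac aff_field)) z = 0" for \<alpha> \<beta>
    using assms(2) by (simp add: invariant_surface_def)
  show "\<tau> * z (U 1 0) + z (U 0 1) = f (z X) * z (U 0 0) + g (z T)"
    using s[of 0 0] by (simp add: charac_def lift_def)
  show "\<tau> * z (U 1 1) + z (U 0 2) = f1 (z X) * z (U 0 0) + f (z X) * z (U 0 1)"
    using s[of 0 1] Dx_charac[OF z, of 1] by simp
qed

text \<open>The field vanishes nowhere because its \<open>x\<close>-coefficient is 1, and constants
  are smooth; what remains is smoothness of the \<open>u\<close>-coefficient and the invariance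
  itself.\<close>

lemma aff_cond_invariant:
  assumes sm: "smooth (jets_over \<Omega>) (\<lambda>z. f (z X) * z (U 0 0) + g (z T))"
    and "\<And>z. z \<in> jets_over \<Omega> \<Longrightarrow> wave z = 0 \<Longrightarrow> z \<in> invariant_surface 2 aff_field
          \<Longrightarrow> prolong 2 aff_field wave z = 0"
  shows "cond_invariant \<Omega> 2 wave aff_field"
proof -
  have W: "open (jets_over \<Omega>)"
    using \<Omega> by (rule open_jets_over)
  have "smooth (jets_over \<Omega>) (\<lambda>z. k)" for k
    by (intro smooth_poly[OF W] alg_const)
  then have "vector_field_on \<Omega> aff_field"
    using sm by (simp add: vector_field_on_def lift_def[abs_def])
  then show ?thesis
    using assms(2) \<Omega> of_order_wave smooth_wave[OF W] by (auto simp: cond_invariant_def)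
qed

end

text \<open>The digit in \<open>e2\<close>, \<open>e1\<close>, \<open>e0\<close> is the power of
  \<open>u\<close> whose coefficient in the invariance condition it annihilates.\<close>

lemma cond_invariant_ansatz:
  fixes f f1 f2 g g1 g2 :: "real \<Rightarrow> real"
  assumes \<Omega>: "open \<Omega>"
    and D: "\<And>t x u. (t, x, u) \<in> \<Omega> \<Longrightarrow> (f has_real_derivative f1 x) (at x)"
      "\<And>t x u. (t, x, u) \<in> \<Omega> \<Longrightarrow> (f1 has_real_derivative f2 x) (at x)"
      "\<And>t x u. (t, x, u) \<in> \<Omega> \<Longrightarrow> (g has_real_derivative g1 t) (at t)"
      "\<And>t x u. (t, x, u) \<in> \<Omega> \<Longrightarrow> (g1 has_real_derivative g2 t) (at t)"
    and sm: "smooth (jets_over \<Omega>) (\<lambda>z. f (z X) * z (U 0 0) + g (z T))"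
    and e2: "\<And>t x u. (t, x, u) \<in> \<Omega> \<Longrightarrow> f2 x + 5 * f x * f1 x + 2 * f x ^ 3 + (f x)\<^sup>2 + f1 x = 0"
    and e1: "\<And>t x u. (t, x, u) \<in> \<Omega> \<Longrightarrow> g t * (4 * (f x)\<^sup>2 + 2 * f x + 5 * f1 x) = 0"
    and e0: "\<And>t x u. (t, x, u) \<in> \<Omega> \<Longrightarrow> g2 t = (2 * f x + 1) * (g t)\<^sup>2"
  shows "cond_invariant \<Omega> 2 wave (VF (\<lambda>t x u. 0) (\<lambda>t x u. 1) (\<lambda>t x u. f x * u + g t))"
proof -
  interpret affine_operator \<Omega> f f1 f2 g g1 g2 0
    using \<Omega> D by unfold_locales
  show ?thesis
  proof (rule aff_cond_invariant[OF sm])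
    fix z
    assume z: "z \<in> jets_over \<Omega>" and "wave z = 0"
      and s: "z \<in> invariant_surface 2 (VF (\<lambda>t x u. 0) (\<lambda>t x u. 1) (\<lambda>t x u. f x * u + g t))"
    note surf = aff_invariant_surface[OF z s]
    define F F1 F2 G u p q where "F = f (z X)" and "F1 = f1 (z X)" and "F2 = f2 (z X)"
      and "G = g (z T)" and "u = z (U 0 0)" and "p = z (U 0 1)" and "q = z (U 0 2)"
    note defs = F_def F1_def F2_def G_def u_def p_def q_def
    have p: "p = F * u + G" and q: "q = F1 * u + F * (F * u + G)"
      using surf by (simp_all add: defs)
    have utt: "z (U 2 0) = p * p + u * q + u * p"
      using \<open>wave z = 0\<close> by (simp add: wave_eq defs)
    have E: "F2 + 5 * F * F1 + 2 * F ^ 3 + F\<^sup>2 + F1 = 0" "G * (4 * F\<^sup>2 + 2 * F + 5 * F1) = 0"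
      "g2 (z T) = (2 * F + 1) * G\<^sup>2"
      using z e0 e1 e2 by (auto simp: jets_over_def defs)
    have "prolong 2 (VF (\<lambda>t x u. 0) (\<lambda>t x u. 1) (\<lambda>t x u. f x * u + g t)) wave z
      = F * (p * p + u * q + u * p) + g2 (z T) - (F * u + G) * (q + p)
        - (F1 * u + F * p) * (2 * p + u) - (F2 * u + 2 * F1 * p + F * q) * u"
      unfolding prolong_wave prolong_coeff_aff[OF z] utt defs by simp
    \<comment> \<open>Eliminating \<open>p\<close> and \<open>q\<close> leaves a quadratic
      polynomial in the free coordinate \<open>u\<close>.\<close>
    also have "\<dots> = - (F2 + 5 * F * F1 + 2 * F ^ 3 + F\<^sup>2 + F1) * u\<^sup>2
        - G * (4 * F\<^sup>2 + 2 * F + 5 * F1) * u + (g2 (z T) - (2 * F + 1) * G\<^sup>2)"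
      unfolding p q by (simp add: algebra_simps power2_eq_square power3_eq_cube)
    also have "\<dots> = 0"
      unfolding E by simp
    finally show "prolong 2 (VF (\<lambda>t x u. 0) (\<lambda>t x u. 1) (\<lambda>t x u. f x * u + g t)) wave z = 0" .
  qed
qed

section \<open>The five operators\<close>

text \<open>\<open>a\<close> inverts the strictly monotone function \<open>\<sigma> G - c2\<close>,
  so the inverse function theorem yields \<open>a' = \<sigma> sqrt (R a) / 3\<close>.
  Differentiating once more, with \<open>R' = 18 u^2\<close> and \<open>\<sigma>^2 = 1\<close>,
  gives \<open>a'' = a^2\<close>.\<close>

lemma implicitly_given_DERIV:
  assumes "open I" "implicitly_given I a c1 c2"
  obtains b where "\<And>t. t \<in> I \<Longrightarrow> (a has_real_derivative b t) (at t)"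
    "\<And>t. t \<in> I \<Longrightarrow> (b has_real_derivative (a t)\<^sup>2) (at t)"
proof -
  define R where "R u = 6 * u ^ 3 + 3 * c1" for u :: real
  from assms(2) obtain \<sigma> :: real and G where "\<sigma> \<in> {1, -1}"
    and "\<forall>u. R u > 0 \<longrightarrow> (G has_real_derivative 3 / sqrt (R u)) (at u)"
    and "\<forall>t\<in>I. R (a t) > 0 \<and> \<sigma> * G (a t) - t - c2 = 0"
    unfolding implicitly_given_def R_def by blast
  then have \<sigma>: "\<sigma> = 1 \<or> \<sigma> = -1"
    and G: "\<And>u. R u > 0 \<Longrightarrow> (G has_real_derivative 3 / sqrt (R u)) (at u)"
    and a: "\<And>t. t \<in> I \<Longrightarrow> R (a t) > 0" "\<And>t. t \<in> I \<Longrightarrow> \<sigma> * G (a t) - t - c2 = 0"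
    by auto
  \<comment> \<open>Monotonicity makes the set where \<open>R\<close> is positive upward closed, so
    \<open>G\<close> is strictly increasing, hence injective, on it.\<close>
  have R_mono: "R u \<le> R v" if "u \<le> v" for u v
    using that power_mono_odd[of 3 u v] by (simp add: R_def)
  have G_less: "G u < G v" if "R u > 0" "u < v" for u v
  proof (rule DERIV_pos_imp_increasing[OF that(2)])
    fix w assume "u \<le> w"
    with R_mono[of u w] that(1) have "R w > 0" by linarith
    then show "\<exists>D. (G has_real_derivative D) (at w) \<and> D > 0"
      using G[of w] by (intro exI[of _ "3 / sqrt (R w)"]) auto
  qed
  have G_inj: "u = v" if "R u > 0" "R v > 0" "G u = G v" for u v
    using that G_less[of u v] G_less[of v u] by (cases u v rule: linorder_cases) auto
  define f where "f u = \<sigma> * G u - c2" for u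
  have f: "(f has_real_derivative \<sigma> * (3 / sqrt (R u))) (at u)" if "R u > 0" for u
    unfolding f_def using G[OF that] by (auto intro!: derivative_eq_intros)
  have fa: "f (a t) = t" if "t \<in> I" for t
    using a(2)[OF that] by (simp add: f_def)
  define S where "S = {u. R u > 0}"
  have "open S"
    unfolding S_def R_def by (intro open_Collect_less continuous_intros)
  have contf: "continuous_on S f"
    using DERIV_isCont[OF f] by (intro continuous_at_imp_continuous_on) (auto simp: S_def)
  \<comment> \<open>Restricting to points that \<open>f\<close> sends into \<open>I\<close> makes
    \<open>a\<close> a left inverse of \<open>f\<close>: there \<open>f (a (f w)) = f w\<close>, and
    \<open>G\<close> is injective.\<close>
  define S' where "S' = S \<inter> f -` I"
  have "open S'"
    unfolding S'_def by (rule continuous_open_preimage[OF contf \<open>open S\<close> assms(1)])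
  define b where "b t = \<sigma> * sqrt (R (a t)) / 3" for t
  have b: "(a has_real_derivative b t) (at t)" if "t \<in> I" for t
  proof -
    define D where "D = \<sigma> * (3 / sqrt (R (a t)))"
    have "D \<noteq> 0" and D_inv: "inverse D = b t"
      using \<sigma> a(1)[OF that] by (auto simp: D_def b_def)
    have "(a has_derivative (*) (inverse D)) (at (f (a t)))"
    \<comment> \<open>This form of the inverse function theorem asks for continuity of
      \<open>f\<close>, not of the inverse \<open>a\<close>.\<close>
    proof (rule has_derivative_inverse_strong[where S=S' and f=f and f'="(*) D"])
      show "(f has_derivative (*) D) (at (a t))"
        using f[OF a(1)[OF that]] by (simp add: has_field_derivative_def D_def)
      show "(*) D \<circ> (*) (inverse D) = id"
        using \<open>D \<noteq> 0\<close> by (auto simp: fun_eq_iff)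
      show "open S'" by fact
      show "a t \<in> S'" using that a fa by (auto simp: S'_def S_def)
      show "continuous_on S' f" using contf by (rule continuous_on_subset) (auto simp: S'_def)
      show "a (f w) = w" if "w \<in> S'" for w
      proof -
        from that have w: "f w \<in> I" "R w > 0" by (auto simp: S'_def S_def)
        have "f (a (f w)) = f w" using w(1) by (rule fa)
        then have "G (a (f w)) = G w" using \<sigma> by (auto simp: f_def)
        with a(1)[OF w(1)] w(2) show ?thesis by (rule G_inj)
      qed
    qed
    then show ?thesis
      by (simp add: fa[OF that] D_inv has_field_derivative_def)
  qed
  have "(b has_real_derivative (a t)\<^sup>2) (at t)" if "t \<in> I" for t
  proof -
    have "((\<lambda>t. R (a t)) has_real_derivative 18 * (a t)\<^sup>2 * b t) (at t)"
      unfolding R_def using b[OF that] by (auto intro!: derivative_eq_intros)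
    then have "(b has_real_derivative \<sigma> * (18 * (a t)\<^sup>2 * b t * (inverse (sqrt (R (a t))) / 2)) / 3) (at t)"
      unfolding b_def using a(1)[OF that]
      by (auto intro!: derivative_eq_intros)
    moreover have "\<sigma> * (18 * (a t)\<^sup>2 * b t * (inverse (sqrt (R (a t))) / 2)) / 3 = (a t)\<^sup>2"
      using \<sigma> a(1)[OF that] by (auto simp: b_def)
    ultimately show ?thesis by (rule DERIV_cong)
  qed
  with b that show ?thesis by blast
qed

section \<open>Smoothness and invariance for each operator\<close>

lemma continuous_on_comp_coord:
  assumes "\<And>z. z \<in> W \<Longrightarrow> (h has_real_derivative D z) (at (z c))"
  shows "continuous_on W (\<lambda>z::jet. h (z c))"
proof -
  have "continuous_on ((\<lambda>z. z c) ` W) h"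
    by (intro continuous_at_imp_continuous_on) (auto dest: assms DERIV_isCont)
  then show ?thesis
    by (rule continuous_on_compose2)
       (auto intro: continuous_on_subset[OF continuous_on_product_coordinates])
qed

lemma cond_invariant_op1:
  assumes "open I" "implicitly_given I a c1 c2"
  shows "cond_invariant (I \<times> UNIV \<times> UNIV) 2 wave (VF (\<lambda>t x u. 0) (\<lambda>t x u. 1) (\<lambda>t x u. a t))"
proof -
  obtain b where a: "\<And>t. t \<in> I \<Longrightarrow> (a has_real_derivative b t) (at t)"
    and b: "\<And>t. t \<in> I \<Longrightarrow> (b has_real_derivative (a t)\<^sup>2) (at t)"
    using implicitly_given_DERIV[OF assms] by blast
  define \<Omega> where "\<Omega> = I \<times> (UNIV::real set) \<times> (UNIV::real set)"
  have \<Omega>: "open \<Omega>"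
    unfolding \<Omega>_def using assms(1) by (intro open_Times open_UNIV)
  have I: "z T \<in> I" if "z \<in> jets_over \<Omega>" for z
    using that by (auto simp: jets_over_def \<Omega>_def)
  \<comment> \<open>Two generators suffice, since \<open>a' = b\<close> and \<open>b' = a^2\<close>
    are polynomials in them.\<close>
  let ?B = "{\<lambda>z. a (z T), \<lambda>z. b (z T)}"
  have "smooth (jets_over \<Omega>) (\<lambda>z. a (z T))"
  proof (rule smooth_alg[OF open_jets_over[OF \<Omega>], of ?B])
    have "continuous_on (jets_over \<Omega>) (\<lambda>z. a (z T))" "continuous_on (jets_over \<Omega>) (\<lambda>z. b (z T))"
      by (rule continuous_on_comp_coord, rule a, erule I)
         (rule continuous_on_comp_coord, rule b, erule I)
    then show "continuous_on (jets_over \<Omega>) F" if "F \<in> ?B" for F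
      using that by auto
    show "\<exists>H. alg ?B H \<and> (\<forall>z\<in>jets_over \<Omega>. ((\<lambda>s. F (z(c := s))) has_real_derivative H z) (at (z c)))"
      if "F \<in> ?B" for F c
      using that
    proof (elim insertE emptyE)
      assume F: "F = (\<lambda>z. a (z T))"
      show ?thesis unfolding F
        by (intro exI[of _ "\<lambda>z. b (z T) * of_bool (T = c)"] conjI ballI alg_mult alg_const
              DERIV_comp_coord a I) (auto intro: alg_base)
    next
      assume F: "F = (\<lambda>z. b (z T))"
      show ?thesis unfolding F
        by (intro exI[of _ "\<lambda>z. (a (z T))\<^sup>2 * of_bool (T = c)"] conjI ballI
              DERIV_comp_coord b I)
           (auto simp: power2_eq_square intro!: alg_mult alg_const intro: alg_base)
    qed
  qed (auto intro: alg_base)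
  with \<Omega> a b have "cond_invariant \<Omega> 2 wave
      (VF (\<lambda>t x u. 0) (\<lambda>t x u. 1) (\<lambda>t x u. (\<lambda>x. 0) x * u + a t))"
    by (intro cond_invariant_ansatz[where f="\<lambda>x. 0" and ?f1.0="\<lambda>x. 0" and ?f2.0="\<lambda>x. 0"
          and g=a and ?g1.0=b and ?g2.0="\<lambda>t. (a t)\<^sup>2"]) (auto simp: \<Omega>_def)
  then show ?thesis by (simp add: \<Omega>_def)
qed

text \<open>Treats \<open>tanh (x/2)\<close> and \<open>coth (x/2)\<close> together: both solve
  \<open>h' = (1 - h^2) / 2\<close>. This Riccati equation makes all derivatives of \<open>h\<close>
  polynomials in \<open>h\<close>, so \<open>h\<close> alone generates a closed algebra and the
  condition on \<open>f = (h - 1) / 4\<close> is a polynomial identity.\<close>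

lemma cond_invariant_riccati:
  fixes h :: "real \<Rightarrow> real"
  assumes \<Omega>: "open \<Omega>"
    and h: "\<And>t x u. (t, x, u) \<in> \<Omega> \<Longrightarrow> (h has_real_derivative (1 - (h x)\<^sup>2) / 2) (at x)"
  shows "cond_invariant \<Omega> 2 wave (VF (\<lambda>t x u. 0) (\<lambda>t x u. 1) (\<lambda>t x u. 1/4 * (h x - 1) * u))"
proof -
  have hz: "(h has_real_derivative (1 - (h (z X))\<^sup>2) / 2) (at (z X))" if "z \<in> jets_over \<Omega>" for z
    using that h by (auto simp: jets_over_def)
  let ?B = "{\<lambda>z. h (z X)}"
  have "smooth (jets_over \<Omega>) (\<lambda>z. 1/4 * (h (z X) - 1) * z (U 0 0) + 0)"
  proof (rule smooth_alg[OF open_jets_over[OF \<Omega>], of ?B])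
    show "continuous_on (jets_over \<Omega>) F" if "F \<in> ?B" for F
      using that by (auto intro: continuous_on_comp_coord hz)
    show "\<exists>H. alg ?B H \<and> (\<forall>z\<in>jets_over \<Omega>. ((\<lambda>s. F (z(c := s))) has_real_derivative H z) (at (z c)))"
      if "F \<in> ?B" for F c
    proof -
      have F: "F = (\<lambda>z. h (z X))" using that by simp
      have "alg ?B (\<lambda>z. (1 - h (z X) * h (z X)) * (1/2) * of_bool (X = c))"
        by (intro alg_mult alg_diff alg_const alg_base) auto
      then show ?thesis unfolding F
        by (intro exI[of _ "\<lambda>z. (1 - (h (z X))\<^sup>2) / 2 * of_bool (X = c)"] conjI ballI
              DERIV_comp_coord hz) (simp_all add: power2_eq_square)
    qed
    show "alg ?B (\<lambda>z. 1/4 * (h (z X) - 1) * z (U 0 0) + 0)"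
      by (intro alg_add alg_mult alg_diff alg_const alg_coord alg_base) auto
  qed
  then have "cond_invariant \<Omega> 2 wave
      (VF (\<lambda>t x u. 0) (\<lambda>t x u. 1) (\<lambda>t x u. 1/4 * (h x - 1) * u + (\<lambda>t. 0) t))"
  proof (intro cond_invariant_ansatz[where f="\<lambda>x. 1/4 * (h x - 1)" and ?f1.0="\<lambda>x. (1 - (h x)\<^sup>2) / 8"
          and ?f2.0="\<lambda>x. - h x * (1 - (h x)\<^sup>2) / 8" and g="\<lambda>t. 0" and ?g1.0="\<lambda>t. 0" and ?g2.0="\<lambda>t. 0"] \<Omega>)
    fix t x u assume "(t, x, u) \<in> \<Omega>"
    note d = h[OF this]
    show "((\<lambda>x. 1/4 * (h x - 1)) has_real_derivative (1 - (h x)\<^sup>2) / 8) (at x)"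
      using d by (auto intro!: derivative_eq_intros)
    show "((\<lambda>x. (1 - (h x)\<^sup>2) / 8) has_real_derivative - h x * (1 - (h x)\<^sup>2) / 8) (at x)"
      using d by (auto intro!: derivative_eq_intros simp: field_simps)
    show "- h x * (1 - (h x)\<^sup>2) / 8 + 5 * (1/4 * (h x - 1)) * ((1 - (h x)\<^sup>2) / 8)
        + 2 * (1/4 * (h x - 1)) ^ 3 + (1/4 * (h x - 1))\<^sup>2 + (1 - (h x)\<^sup>2) / 8 = 0"
      by (simp add: field_simps power2_eq_square power3_eq_cube)
  qed auto
  then show ?thesis by simp
qed

lemma DERIV_tanh_half: "((\<lambda>x. tanh (1/2 * x)) has_real_derivative (1 - (tanh (1/2 * x))\<^sup>2) / 2) (at x)"
  for x :: real
  by (auto intro!: derivative_eq_intros)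

text \<open>The quotient rule gives \<open>(sinh^2 - cosh^2) / sinh^2 = 1 - coth^2\<close>, halved
  by the inner derivative.\<close>

lemma DERIV_coth_half:
  assumes "x \<noteq> 0"
  shows "((\<lambda>x. coth (1/2 * x)) has_real_derivative (1 - (coth (1/2 * x))\<^sup>2) / 2) (at x)"
proof -
  have "sinh (1/2 * x) \<noteq> 0"
    using assms by simp
  then show ?thesis
    unfolding coth_def
    by (auto intro!: derivative_eq_intros simp: field_simps power2_eq_square)
qed

text \<open>For constant \<open>f = -1/2\<close> the factor \<open>2 f + 1\<close> vanishes. It
  divides \<open>2 f^3 + f^2\<close> and \<open>4 f^2 + 2 f\<close>, and it reduces the last
  condition to \<open>g'' = 0\<close>, which affine \<open>g\<close> satisfy.\<close>

lemma cond_invariant_op4: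
  "cond_invariant UNIV 2 wave (VF (\<lambda>t x u. 0) (\<lambda>t x u. 1) (\<lambda>t x u. - u / 2 + \<alpha> * t + \<beta>))"
proof -
  have "smooth (jets_over UNIV) (\<lambda>z. - (1/2) * z (U 0 0) + (\<alpha> * z T + \<beta>))"
    by (intro smooth_poly open_jets_over open_UNIV alg_add alg_mult alg_const alg_coord)
  then have "cond_invariant UNIV 2 wave
      (VF (\<lambda>t x u. 0) (\<lambda>t x u. 1) (\<lambda>t x u. - (1/2) * u + (\<alpha> * t + \<beta>)))"
    by (intro cond_invariant_ansatz[where f="\<lambda>x. - (1/2)" and ?f1.0="\<lambda>x. 0" and ?f2.0="\<lambda>x. 0"
          and g="\<lambda>t. \<alpha> * t + \<beta>" and ?g1.0="\<lambda>t. \<alpha>" and ?g2.0="\<lambda>t. 0"])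
       (auto intro!: derivative_eq_intros simp: power2_eq_square power3_eq_cube)
  then show ?thesis by (simp add: algebra_simps)
qed

text \<open>With \<open>f = g = 0\<close> the prolongation coefficients entering
  \<open>prolong_wave\<close> vanish at every jet, on or off the equation.\<close>

lemma cond_invariant_op5:
  "cond_invariant UNIV 2 wave (VF (\<lambda>t x u. 1) (\<lambda>t x u. 1) (\<lambda>t x u. 0))"
proof -
  interpret affine_operator UNIV "\<lambda>x. 0" "\<lambda>x. 0" "\<lambda>x. 0" "\<lambda>t. 0" "\<lambda>t. 0" "\<lambda>t. 0" 1
    by unfold_locales simp_all
  have "smooth (jets_over UNIV) (\<lambda>z. 0 * z (U 0 0) + 0)"
    by (intro smooth_poly open_jets_over open_UNIV alg_add alg_mult alg_const alg_coord)
  then have "cond_invariant UNIV 2 wave (VF (\<lambda>t x u. 1) (\<lambda>t x u. 1) (\<lambda>t x u. 0 * u + 0))"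
  proof (rule aff_cond_invariant)
    fix z :: jet
    assume z: "z \<in> jets_over UNIV"
    show "prolong 2 (VF (\<lambda>t x u. 1) (\<lambda>t x u. 1) (\<lambda>t x u. 0 * u + 0)) wave z = 0"
      unfolding prolong_wave prolong_coeff_aff[OF z] by simp
  qed
  then show ?thesis by simp
qed

lemma open_x_nonzero: "open {(t::real, x::real, u::real). x \<noteq> 0}"
proof -
  have "{(t::real, x::real, u::real). x \<noteq> 0} = UNIV \<times> (- {0}) \<times> UNIV"
    by auto
  also have "open \<dots>"
    by (intro open_Times open_UNIV) auto
  finally show ?thesis .
qed

theorem theorem14:
  shows "(\<forall>I a c1 c2. open I \<and> implicitly_given I a c1 c2 \<longrightarrow>
            cond_invariant (I \<times> UNIV \<times> UNIV) 2 wave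
              (VF (\<lambda>t x u. 0) (\<lambda>t x u. 1) (\<lambda>t x u. a t)))
       \<and> cond_invariant UNIV 2 wave
           (VF (\<lambda>t x u. 0) (\<lambda>t x u. 1) (\<lambda>t x u. 1/4 * (tanh (1/2 * x) - 1) * u))
       \<and> cond_invariant {(t, x, u). x \<noteq> 0} 2 wave
           (VF (\<lambda>t x u. 0) (\<lambda>t x u. 1) (\<lambda>t x u. 1/4 * (coth (1/2 * x) - 1) * u))
       \<and> (\<forall>\<alpha> \<beta>. cond_invariant UNIV 2 wave
           (VF (\<lambda>t x u. 0) (\<lambda>t x u. 1) (\<lambda>t x u. - u / 2 + \<alpha> * t + \<beta>)))
       \<and> cond_invariant UNIV 2 wave
           (VF (\<lambda>t x u. 1) (\<lambda>t x u. 1) (\<lambda>t x u. 0))"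
  using cond_invariant_op1 cond_invariant_op4 cond_invariant_op5
    cond_invariant_riccati[OF open_UNIV DERIV_tanh_half]
    cond_invariant_riccati[OF open_x_nonzero DERIV_coth_half]
  by auto

end
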